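(* Let $A$ be a $C^*$-algebra. The assignment $I \mapsto T(I)$ is a bijection from the set of semiprime two-sided ideals $I$ in $A$ such that $A/I$ contains no nonzero, commutative two-sided ideal, onto the set of semiprime Lie ideals in $A$. This assignment restricts to a bijection from the set of prime two-sided ideals $I$ in $A$ such that $A/I$ contains no nonzero, commutative two-sided ideal, onto the set of prime Lie ideals in $A$.
   Context: A $C^*$-algebra $A$ need not be unital. For $a,b\in A$ put $[a,b]:=ab-ba$; for subsets $E,F\subseteq A$, $[E,F]$ denotes the linear span of $\{[a,b]:a\in E,b\in F\}$. A two-sided ideal in $A$ is a linear subspace $I\subseteq A$ (not necessarily closed) with $ax,xa\in I$ for all $a\in A$, $x\in I$; the quotient $A/I$ is an algebraic quotient. A two-sided ideal $I$ is prime if $I\neq A$ and, for all two-sided ideals $I_1,I_2$, $I_1I_2\subseteq I$ implies $I_1\subseteq I$ or $I_2\subseteq I$; it is semiprime if for every two-sided ideal $J$, $J^2\subseteq I$ implies $J\subseteq I$ (equivalently, $I$ is an intersection of prime ideals, with $A$ itself being the empty intersection). A Lie ideal in $A$ is a linear subspace $L\subseteq A$ (not necessarily closed) with $[A,L]\subseteq L$. A Lie ideal $L$ is prime if $L\neq A$ and, for all Lie ideals $K_1,K_2\subseteq A$ with $[K_1,K_2]\subseteq L$, one has $K_1\subseteq L$ or $K_2\subseteq L$. A Lie ideal $L$ is semiprime if for every Lie ideal $K\subseteq A$ with $[K,K]\subseteq L$ one has $K\subseteq L$. For a linear subspace $L\subseteq A$, the full normalizer subspace is $T(L):=\{a\in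 A:[A,a]\subseteq L\}$. *)

theory Defs
  imports Complex_Main
begin

text \<open>Complex, not necessarily unital, possibly zero C*-algebras. The class
  \<open>real_normed_algebra\<close> has no unit; completeness comes from \<open>banach\<close>.\<close>

class c_star_algebra = real_normed_algebra + banach +
  fixes scaleC :: "complex \<Rightarrow> 'a \<Rightarrow> 'a"  (infixr \<open>*\<^sub>C\<close> 75)
    and star :: "'a \<Rightarrow> 'a"
  assumes scaleC_add_right: "c *\<^sub>C (x + y) = c *\<^sub>C x + c *\<^sub>C y"
    and scaleC_add_left: "(c + d) *\<^sub>C x = c *\<^sub>C x + d *\<^sub>C x"
    and scaleC_scaleC: "c *\<^sub>C (d *\<^sub>C x) = (c * d) *\<^sub>C x"
    and scaleC_of_real: "complex_of_real r *\<^sub>C x = r *\<^sub>R x"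
    and mult_scaleC_left: "(c *\<^sub>C x) * y = c *\<^sub>C (x * y)"
    and mult_scaleC_right: "x * (c *\<^sub>C y) = c *\<^sub>C (x * y)"
    and norm_scaleC: "norm (c *\<^sub>C x) = cmod c * norm x"
    and star_star: "star (star x) = x"
    and star_add: "star (x + y) = star x + star y"
    and star_scaleC: "star (c *\<^sub>C x) = cnj c *\<^sub>C star x"
    and star_mult: "star (x * y) = star y * star x"
    and c_star_identity: "norm (star x * x) = (norm x)\<^sup>2"

global_interpretation complex_vector: vector_space "scaleC :: complex \<Rightarrow> 'a \<Rightarrow> 'a::c_star_algebra"
  defines csubspace = complex_vector.subspace
    and cspan = complex_vector.span
proof
  fix x :: 'a
  show "1 *\<^sub>C x = x"
    using scaleC_of_real[of 1 x] by simp
qed (simp_all add: scaleC_add_right scaleC_add_left scaleC_scaleC)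

definition two_sided_ideal :: "'a::c_star_algebra set \<Rightarrow> bool" where
  "two_sided_ideal I \<longleftrightarrow> csubspace I \<and> (\<forall>a. \<forall>x\<in>I. a * x \<in> I \<and> x * a \<in> I)"

definition ideal_prod :: "'a::c_star_algebra set \<Rightarrow> 'a set \<Rightarrow> 'a set" where
  "ideal_prod I J = cspan {x * y |x y. x \<in> I \<and> y \<in> J}"

definition prime_ideal :: "'a::c_star_algebra set \<Rightarrow> bool" where
  "prime_ideal I \<longleftrightarrow> two_sided_ideal I \<and> I \<noteq> UNIV \<and>
     (\<forall>I\<^sub>1 I\<^sub>2. two_sided_ideal I\<^sub>1 \<longrightarrow> two_sided_ideal I\<^sub>2 \<longrightarrow> ideal_prod I\<^sub>1 I\<^sub>2 \<subseteq> I \<longrightarrow>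
        I\<^sub>1 \<subseteq> I \<or> I\<^sub>2 \<subseteq> I)"

definition semiprime_ideal :: "'a::c_star_algebra set \<Rightarrow> bool" where
  "semiprime_ideal I \<longleftrightarrow> two_sided_ideal I \<and>
     (\<forall>J. two_sided_ideal J \<longrightarrow> ideal_prod J J \<subseteq> I \<longrightarrow> J \<subseteq> I)"

text \<open>Elements of the quotient are cosets. The operations are unions over all representatives;
  if \<open>I\<close> is a two-sided ideal, all the cosets in such a union coincide.\<close>

definition coset :: "'a::c_star_algebra set \<Rightarrow> 'a \<Rightarrow> 'a set" where
  "coset I a = (\<lambda>x. a + x) ` I"

definition quot :: "'a::c_star_algebra set \<Rightarrow> 'a set set" where
  "quot I = range (coset I)"

definition quot_add :: "'a::c_star_algebra set \<Rightarrow> 'a set \<Rightarrow> 'a set \<Rightarrow> 'a set" where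
  "quot_add I X Y = (\<Union>a\<in>X. \<Union>b\<in>Y. coset I (a + b))"

definition quot_scaleC :: "'a::c_star_algebra set \<Rightarrow> complex \<Rightarrow> 'a set \<Rightarrow> 'a set" where
  "quot_scaleC I c X = (\<Union>a\<in>X. coset I (c *\<^sub>C a))"

definition quot_mult :: "'a::c_star_algebra set \<Rightarrow> 'a set \<Rightarrow> 'a set \<Rightarrow> 'a set" where
  "quot_mult I X Y = (\<Union>a\<in>X. \<Union>b\<in>Y. coset I (a * b))"

definition quot_two_sided_ideal :: "'a::c_star_algebra set \<Rightarrow> 'a set set \<Rightarrow> bool" where
  "quot_two_sided_ideal I J \<longleftrightarrow>
     J \<subseteq> quot I \<and> coset I 0 \<in> J \<and>
     (\<forall>X\<in>J. \<forall>Y\<in>J. quot_add I X Y \<in> J) \<and>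
     (\<forall>c. \<forall>X\<in>J. quot_scaleC I c X \<in> J) \<and>
     (\<forall>Z\<in>quot I. \<forall>X\<in>J. quot_mult I Z X \<in> J \<and> quot_mult I X Z \<in> J)"

definition quot_commutative :: "'a::c_star_algebra set \<Rightarrow> 'a set set \<Rightarrow> bool" where
  "quot_commutative I J \<longleftrightarrow> (\<forall>X\<in>J. \<forall>Y\<in>J. quot_mult I X Y = quot_mult I Y X)"

definition quot_no_nonzero_commutative_ideal :: "'a::c_star_algebra set \<Rightarrow> bool" where
  "quot_no_nonzero_commutative_ideal I \<longleftrightarrow>
     \<not> (\<exists>J. quot_two_sided_ideal I J \<and> J \<noteq> {coset I 0} \<and> quot_commutative I J)"

definition commutator :: "'a::c_star_algebra \<Rightarrow> 'a \<Rightarrow> 'a" where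
  "commutator a b = a * b - b * a"

definition commutator_span :: "'a::c_star_algebra set \<Rightarrow> 'a set \<Rightarrow> 'a set" where
  "commutator_span E F = cspan {commutator a b |a b. a \<in> E \<and> b \<in> F}"

definition lie_ideal :: "'a::c_star_algebra set \<Rightarrow> bool" where
  "lie_ideal L \<longleftrightarrow> csubspace L \<and> commutator_span UNIV L \<subseteq> L"

definition prime_lie_ideal :: "'a::c_star_algebra set \<Rightarrow> bool" where
  "prime_lie_ideal L \<longleftrightarrow> lie_ideal L \<and> L \<noteq> UNIV \<and>
     (\<forall>K\<^sub>1 K\<^sub>2. lie_ideal K\<^sub>1 \<longrightarrow> lie_ideal K\<^sub>2 \<longrightarrow> commutator_span K\<^sub>1 K\<^sub>2 \<subseteq> L \<longrightarrow>
        K\<^sub>1 \<subseteq> L \<or> K\<^sub>2 \<subseteq> L)"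

definition semiprime_lie_ideal :: "'a::c_star_algebra set \<Rightarrow> bool" where
  "semiprime_lie_ideal L \<longleftrightarrow> lie_ideal L \<and>
     (\<forall>K. lie_ideal K \<longrightarrow> commutator_span K K \<subseteq> L \<longrightarrow> K \<subseteq> L)"

definition full_normalizer :: "'a::c_star_algebra set \<Rightarrow> 'a set" where
  "full_normalizer L = {a. commutator_span UNIV {a} \<subseteq> L}"

end

theory Submission
  imports Defs
begin

text \<open>
  The inverse of \<open>I \<mapsto> T(I)\<close> sends a Lie ideal \<open>L\<close> to its \<^emph>\<open>ideal core\<close>, the largest two-sided
  ideal contained in \<open>L\<close>. The argument is Herstein's Lie theory of associative rings in which one can
  divide by two. Two facts carry it.

  First, let \<open>I\<close> be semiprime; note that \<open>T(I)/I\<close> is the centre of \<open>A/I\<close>. If \<open>K\<close> is a Lie ideal with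
  \<open>[K,K] \<subseteq> T(I)\<close>, then \<open>K \<subseteq> T(I)\<close> (\<open>lie_ideal_commutators_central_mod\<close>): for \<open>u \<in> K\<close> the inner
  derivation \<open>d = [u, _]\<close> has \<open>d\<^sup>2\<close> central modulo \<open>I\<close>. This forces the values of \<open>d\<^sup>2\<close>
  to have square zero, and central elements of square zero vanish in a semiprime ring. So
  \<open>d\<^sup>2 = 0\<close>, and then the Leibniz rule gives \<open>d = 0\<close>. Hence \<open>T(I)\<close> is a
  semiprime Lie ideal. Any ideal contained in \<open>T(I)\<close> is commutative modulo \<open>I\<close>, hence if \<open>A/I\<close> has
  no nonzero commutative ideal, then \<open>I\<close> is the ideal core of \<open>T(I)\<close>.

  Second, for every Lie ideal \<open>L\<close> the space \<open>T(L)\<close> is a subalgebra as well as a Lie ideal, and this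
  forces \<open>[T(L),T(L)]\<close> into the ideal core of \<open>T(L)\<close> (\<open>commutator_mem_ideal_core\<close>). If \<open>L\<close> is a
  semiprime Lie ideal, then \<open>T(L) = L\<close>, and the ideal core \<open>I\<close> of \<open>L\<close> inherits semiprimeness because
  \<open>J\<^sup>2 \<subseteq> I\<close> implies \<open>[J,J] \<subseteq> L\<close>; the same reasoning excludes commutative ideals of \<open>A/I\<close>. Now
  \<open>[L,L] \<subseteq> I\<close>, so the first fact yields \<open>L \<subseteq> T(I)\<close>, and \<open>T(I) \<subseteq> T(L) = L\<close>.

  In the prime case, suppose that \<open>[K\<^sub>1,K\<^sub>2] \<subseteq> T(I)\<close> with neither \<open>K\<^sub>i\<close> inside \<open>T(I)\<close>. The core of
  \<open>T(K\<^sub>i)\<close> contains \<open>[K\<^sub>i,K\<^sub>i]\<close>, so by the first fact it is not in \<open>I\<close>; as \<open>I\<close> is prime, the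
  intersection \<open>M\<close> of the two cores is not in \<open>I\<close> either. But
  \<open>[A,M] \<subseteq> K\<^sub>1 \<inter> K\<^sub>2\<close>, and \<open>K\<^sub>1 \<inter> K\<^sub>2 \<subseteq> T(I)\<close> by the first fact; by the same fact \<open>M \<subseteq> T(I)\<close>, which
  makes \<open>M\<close> a nonzero commutative ideal modulo \<open>I\<close>.
\<close>

section \<open>Subspaces, two-sided ideals and Lie ideals\<close>

lemma csubspace_double_iff:
  assumes "csubspace S"
  shows "p + p \<in> S \<longleftrightarrow> p \<in> S"
proof
  assume "p + p \<in> S"
  then have "(1/2) *\<^sub>C (p + p) \<in> S"
    using assms complex_vector.subspace_scale by blast
  moreover have "(1/2) *\<^sub>C (p + p) = p"
    using scaleC_add_left[of "1/2" "1/2" p] by (simp add: scaleC_add_right)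
  ultimately show "p \<in> S" by simp
qed (rule complex_vector.subspace_add[OF assms])

lemma commutator_minus_swap: "commutator b a = - commutator a b"
  by (simp add: commutator_def)

lemma commutator_span_subset_iff:
  assumes "csubspace S"
  shows "commutator_span E F \<subseteq> S \<longleftrightarrow> (\<forall>a\<in>E. \<forall>b\<in>F. commutator a b \<in> S)"
proof
  have "{commutator a b |a b. a \<in> E \<and> b \<in> F} \<subseteq> commutator_span E F"
    unfolding commutator_span_def by (rule complex_vector.span_superset)
  also assume "commutator_span E F \<subseteq> S"
  finally show "\<forall>a\<in>E. \<forall>b\<in>F. commutator a b \<in> S" by blast
next
  assume "\<forall>a\<in>E. \<forall>b\<in>F. commutator a b \<in> S"
  then show "commutator_span E F \<subseteq> S"
    unfolding commutator_span_def
    using assms by (intro complex_vector.span_minimal) auto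
qed

lemma ideal_prod_subset_iff:
  assumes "csubspace S"
  shows "ideal_prod I J \<subseteq> S \<longleftrightarrow> (\<forall>x\<in>I. \<forall>y\<in>J. x * y \<in> S)"
proof
  have "{x * y |x y. x \<in> I \<and> y \<in> J} \<subseteq> ideal_prod I J"
    unfolding ideal_prod_def by (rule complex_vector.span_superset)
  also assume "ideal_prod I J \<subseteq> S"
  finally show "\<forall>x\<in>I. \<forall>y\<in>J. x * y \<in> S" by blast
next
  assume "\<forall>x\<in>I. \<forall>y\<in>J. x * y \<in> S"
  then show "ideal_prod I J \<subseteq> S"
    unfolding ideal_prod_def
    using assms by (intro complex_vector.span_minimal) auto
qed

lemma mult_mem_ideal_prod: "x \<in> I \<Longrightarrow> y \<in> J \<Longrightarrow> x * y \<in> ideal_prod I J"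
  unfolding ideal_prod_def by (rule complex_vector.span_base) blast

lemma two_sided_idealD:
  assumes "two_sided_ideal I"
  shows "csubspace I" "0 \<in> I"
    and "\<And>x y. x \<in> I \<Longrightarrow> y \<in> I \<Longrightarrow> x + y \<in> I"
    and "\<And>x y. x \<in> I \<Longrightarrow> y \<in> I \<Longrightarrow> x - y \<in> I"
    and "\<And>c x. x \<in> I \<Longrightarrow> c *\<^sub>C x \<in> I"
    and "\<And>a x. x \<in> I \<Longrightarrow> a * x \<in> I"
    and "\<And>a x. x \<in> I \<Longrightarrow> x * a \<in> I"
  using assms complex_vector.subspace_0 complex_vector.subspace_add
    complex_vector.subspace_diff complex_vector.subspace_scale
  unfolding two_sided_ideal_def by blast+

lemma two_sided_ideal_Int:
  "two_sided_ideal I \<Longrightarrow> two_sided_ideal J \<Longrightarrow> two_sided_ideal (I \<inter> J)"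
  unfolding two_sided_ideal_def by (auto intro: complex_vector.subspace_inter)

lemma two_sided_ideal_ideal_prod:
  assumes "two_sided_ideal I" and "two_sided_ideal J"
  shows "two_sided_ideal (ideal_prod I J)"
proof -
  let ?P = "ideal_prod I J"
  have sub: "csubspace ?P"
    unfolding ideal_prod_def by (rule complex_vector.subspace_span)
  note add = complex_vector.subspace_add[OF sub]
  note scale = complex_vector.subspace_scale[OF sub]
  have "a * p \<in> ?P \<and> p * a \<in> ?P" if "p \<in> ?P" for a p
  proof -
    have "csubspace {p. a * p \<in> ?P \<and> p * a \<in> ?P}"
      by (rule complex_vector.subspaceI)
        (auto simp: complex_vector.subspace_0[OF sub] distrib_left distrib_right
          mult_scaleC_left mult_scaleC_right intro: add scale)
    moreover have "x * y \<in> {p. a * p \<in> ?P \<and> p * a \<in> ?P}" if "x \<in> I" "y \<in> J" for x y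
      using mult_mem_ideal_prod[of "a * x" I y J] mult_mem_ideal_prod[of x I "y * a" J] that
        two_sided_idealD(6)[OF assms(1)] two_sided_idealD(7)[OF assms(2)]
      by (simp add: mult.assoc)
    ultimately have "?P \<subseteq> {p. a * p \<in> ?P \<and> p * a \<in> ?P}"
      by (simp add: ideal_prod_subset_iff)
    with \<open>p \<in> ?P\<close> show ?thesis by blast
  qed
  with sub show ?thesis unfolding two_sided_ideal_def by blast
qed

lemma lie_ideal_iff:
  "lie_ideal L \<longleftrightarrow> csubspace L \<and> (\<forall>a. \<forall>x\<in>L. commutator a x \<in> L)"
  unfolding lie_ideal_def using commutator_span_subset_iff[of L UNIV L] by auto

lemma lie_idealD:
  assumes "lie_ideal L"
  shows "csubspace L"
    and "\<And>a x. x \<in> L \<Longrightarrow> commutator a x \<in> L"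
    and "\<And>a x. x \<in> L \<Longrightarrow> commutator x a \<in> L"
proof -
  show sub: "csubspace L" and left: "\<And>a x. x \<in> L \<Longrightarrow> commutator a x \<in> L"
    using assms by (auto simp: lie_ideal_iff)
  show "commutator x a \<in> L" if "x \<in> L" for a x
    using complex_vector.subspace_neg[OF sub left[OF that, of a]]
    by (simp add: commutator_minus_swap[of x a])
qed

lemma lie_ideal_Int: "lie_ideal K \<Longrightarrow> lie_ideal L \<Longrightarrow> lie_ideal (K \<inter> L)"
  unfolding lie_ideal_iff by (auto intro: complex_vector.subspace_inter)

lemma two_sided_ideal_imp_lie_ideal: "two_sided_ideal I \<Longrightarrow> lie_ideal I"
  unfolding lie_ideal_iff commutator_def by (auto intro: two_sided_idealD)

section \<open>The full normalizer subspace\<close>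

lemma mem_full_normalizer_iff:
  assumes "csubspace L"
  shows "a \<in> full_normalizer L \<longleftrightarrow> (\<forall>x. commutator x a \<in> L)"
  unfolding full_normalizer_def using commutator_span_subset_iff[OF assms, of UNIV "{a}"] by auto

lemma full_normalizer_mono: "K \<subseteq> L \<Longrightarrow> full_normalizer K \<subseteq> full_normalizer L"
  unfolding full_normalizer_def by blast

lemma lie_ideal_subset_full_normalizer: "lie_ideal L \<Longrightarrow> L \<subseteq> full_normalizer L"
  using lie_idealD(1,2) mem_full_normalizer_iff by blast

lemma csubspace_full_normalizer:
  assumes "csubspace L"
  shows "csubspace (full_normalizer L)"
proof (rule complex_vector.subspaceI)
  show "0 \<in> full_normalizer L"
    using complex_vector.subspace_0[OF assms]
    by (simp add: mem_full_normalizer_iff[OF assms] commutator_def)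
next
  fix a b assume "a \<in> full_normalizer L" "b \<in> full_normalizer L"
  moreover have "commutator x (a + b) = commutator x a + commutator x b" for x
    by (simp add: commutator_def algebra_simps)
  ultimately show "a + b \<in> full_normalizer L"
    using complex_vector.subspace_add[OF assms] by (simp add: mem_full_normalizer_iff[OF assms])
next
  fix c a assume "a \<in> full_normalizer L"
  moreover have "commutator x (c *\<^sub>C a) = c *\<^sub>C commutator x a" for x
    by (simp add: commutator_def mult_scaleC_left mult_scaleC_right
        complex_vector.scale_right_diff_distrib)
  ultimately show "c *\<^sub>C a \<in> full_normalizer L"
    using complex_vector.subspace_scale[OF assms] by (simp add: mem_full_normalizer_iff[OF assms])
qed

lemma lie_ideal_full_normalizer:
  assumes "lie_ideal L"
  shows "lie_ideal (full_normalizer L)"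
  unfolding lie_ideal_iff
  using csubspace_full_normalizer lie_idealD(1)[OF assms] mem_full_normalizer_iff
    lie_ideal_subset_full_normalizer[OF assms] by blast

text \<open>The identity behind this is \<open>[x, ab] = [xa, b] + [bx, a]\<close>. It makes \<open>T(L)\<close> a subalgebra,
  although \<open>L\<close> itself need not be one.\<close>

lemma full_normalizer_mult:
  assumes L: "csubspace L" and "a \<in> full_normalizer L" "b \<in> full_normalizer L"
  shows "a * b \<in> full_normalizer L"
proof -
  have "commutator x (a * b) = commutator (x * a) b + commutator (b * x) a" for x
    by (simp add: commutator_def algebra_simps)
  then show ?thesis
    using assms complex_vector.subspace_add[OF L] by (simp add: mem_full_normalizer_iff[OF L])
qed

section \<open>The largest two-sided ideal inside a subspace\<close>

text \<open>If \<open>A\<close> had a unit, the condition \<open>AxA \<subseteq> L\<close> would imply the other ones.\<close>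

definition ideal_core :: "'a::c_star_algebra set \<Rightarrow> 'a set" where
  "ideal_core L =
     {x. x \<in> L \<and> (\<forall>a. a * x \<in> L) \<and> (\<forall>a. x * a \<in> L) \<and> (\<forall>a b. a * x * b \<in> L)}"

lemma ideal_core_subset: "ideal_core L \<subseteq> L"
  unfolding ideal_core_def by blast

lemma ideal_core_greatest: "two_sided_ideal J \<Longrightarrow> J \<subseteq> L \<Longrightarrow> J \<subseteq> ideal_core L"
  unfolding ideal_core_def by (auto dest: two_sided_idealD)

lemma two_sided_ideal_ideal_core:
  assumes "csubspace L"
  shows "two_sided_ideal (ideal_core L)"
  unfolding two_sided_ideal_def
proof (intro conjI allI ballI)
  note add = complex_vector.subspace_add[OF assms]
    and scale = complex_vector.subspace_scale[OF assms]
    and zero = complex_vector.subspace_0[OF assms]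
  show "csubspace (ideal_core L)"
    by (rule complex_vector.subspaceI)
      (auto simp: ideal_core_def distrib_left distrib_right mult_scaleC_left mult_scaleC_right zero
        intro: add scale)
  fix a x assume "x \<in> ideal_core L"
  then show "a * x \<in> ideal_core L" "x * a \<in> ideal_core L"
    unfolding ideal_core_def by (auto simp flip: mult.assoc) (auto simp: mult.assoc)
qed

text \<open>In a Lie ideal \<open>T\<close> that is also a subalgebra, \<open>[u,v]a = [u,va] - v[u,a]\<close> shows that \<open>[T,T]A\<close>
  lies in \<open>T\<close>; the products with factors on the left differ from such ones by commutators with
  elements of \<open>T\<close>.\<close>

lemma commutator_mem_ideal_core:
  assumes T: "lie_ideal T" and mult: "\<And>a b. a \<in> T \<Longrightarrow> b \<in> T \<Longrightarrow> a * b \<in> T"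
    and u: "u \<in> T" and v: "v \<in> T"
  shows "commutator u v \<in> ideal_core T"
proof -
  let ?c = "commutator u v"
  note lie = lie_idealD(2,3)[OF T]
    and add = complex_vector.subspace_add[OF lie_idealD(1)[OF T]]
    and diff = complex_vector.subspace_diff[OF lie_idealD(1)[OF T]]
  have c: "?c \<in> T" using v by (rule lie)
  have right: "?c * a \<in> T" for a
  proof -
    have "?c * a = commutator u (v * a) - v * commutator u a"
      by (simp add: commutator_def algebra_simps)
    then show ?thesis using u v by (simp add: diff mult lie)
  qed
  have left: "a * ?c \<in> T" for a
  proof -
    have "a * ?c = commutator a ?c + ?c * a"
      by (simp add: commutator_def)
    then show ?thesis using add lie(1)[OF c] right by simp
  qed
  have "a * ?c * b \<in> T" for a b
  proof -
    have "a * ?c * b = commutator a (?c * b) + ?c * (b * a)"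
      by (simp add: commutator_def[of a] algebra_simps)
    then show ?thesis using add lie(1)[OF right] right by simp
  qed
  with c right left show ?thesis unfolding ideal_core_def by blast
qed

section \<open>Semiprime ideals and central commutators\<close>

text \<open>Semiprimeness is about ideals, so two of them stand in for the one generated by \<open>a\<close>, which is
  awkward without a unit. The span \<open>N\<close> of \<open>AaA\<close> satisfies \<open>N\<^sup>2 \<subseteq> A(aAa)A \<subseteq> I\<close>, hence \<open>N \<subseteq> I\<close>, which
  puts \<open>a\<close> into \<open>J = {x. AxA \<subseteq> I}\<close>. And \<open>J \<subseteq> I\<close>, because \<open>J\<^sup>2\<close> squares into \<open>J\<^sup>3 \<subseteq> AJA \<subseteq> I\<close>.\<close>

lemma semiprime_ideal_sandwich:
  assumes I: "semiprime_ideal I" and a: "\<And>x. a * x * a \<in> I"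
  shows "a \<in> I"
proof -
  have ideal: "two_sided_ideal I"
    and semi: "\<And>J. two_sided_ideal J \<Longrightarrow> (\<And>x y. x \<in> J \<Longrightarrow> y \<in> J \<Longrightarrow> x * y \<in> I) \<Longrightarrow> J \<subseteq> I"
    using I ideal_prod_subset_iff[of I] two_sided_idealD(1)
    unfolding semiprime_ideal_def by blast+
  note D = two_sided_idealD[OF ideal]
  define J where "J = {x. \<forall>b c. b * x * c \<in> I}"
  have J: "two_sided_ideal J"
    unfolding two_sided_ideal_def
  proof (intro conjI allI ballI)
    show "csubspace J"
      unfolding J_def
      by (rule complex_vector.subspaceI)
        (auto simp: D(2) distrib_left distrib_right mult_scaleC_left mult_scaleC_right intro: D)
    fix b x assume "x \<in> J"
    then show "b * x \<in> J" "x * b \<in> J"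
      unfolding J_def by (auto simp flip: mult.assoc) (auto simp: mult.assoc)
  qed
  have sandwich: "x * y * z \<in> I" if "y \<in> J" for x y z
    using that unfolding J_def by blast
  have "ideal_prod J J \<subseteq> I"
  proof (rule semi[OF two_sided_ideal_ideal_prod[OF J J]])
    fix p q assume p: "p \<in> ideal_prod J J" and q: "q \<in> ideal_prod J J"
    have "ideal_prod J J \<subseteq> J"
      using two_sided_idealD[OF J] by (simp add: ideal_prod_subset_iff)
    with p have "p \<in> J" by blast
    have "csubspace {q. p * q \<in> I}"
      by (rule complex_vector.subspaceI) (auto simp: D(2) distrib_left mult_scaleC_right intro: D)
    moreover have "x * y \<in> {q. p * q \<in> I}" if "x \<in> J" "y \<in> J" for x y
      using sandwich[OF that(1), of p y] by (simp add: mult.assoc)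
    ultimately have "ideal_prod J J \<subseteq> {q. p * q \<in> I}"
      by (simp add: ideal_prod_subset_iff)
    with q show "p * q \<in> I" by blast
  qed
  with J have JI: "J \<subseteq> I"
    using I unfolding semiprime_ideal_def by blast
  define N where "N = cspan {b * a * c | b c. True}"
  have subN: "csubspace N" unfolding N_def by (rule complex_vector.subspace_span)
  have genN: "b * a * c \<in> N" for b c
    unfolding N_def by (rule complex_vector.span_base) blast
  have minN: "N \<subseteq> S" if "csubspace S" "\<And>b c. b * a * c \<in> S" for S
    unfolding N_def using that by (intro complex_vector.span_minimal) auto
  have N: "two_sided_ideal N"
    unfolding two_sided_ideal_def
  proof (intro conjI allI ballI)
    fix e x assume x: "x \<in> N"
    have "N \<subseteq> {x. e * x \<in> N \<and> x * e \<in> N}"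
    proof (rule minN)
      show "csubspace {x. e * x \<in> N \<and> x * e \<in> N}"
        by (rule complex_vector.subspaceI)
          (auto simp: complex_vector.subspace_0[OF subN] distrib_left distrib_right
            mult_scaleC_left mult_scaleC_right
            intro: complex_vector.subspace_add[OF subN] complex_vector.subspace_scale[OF subN])
      show "b * a * c \<in> {x. e * x \<in> N \<and> x * e \<in> N}" for b c
        using genN[of "e * b" c] genN[of b "c * e"] by (simp add: mult.assoc)
    qed
    with x show "e * x \<in> N" "x * e \<in> N" by auto
  qed (rule subN)
  have "N \<subseteq> I"
  proof (rule semi[OF N])
    fix p q assume p: "p \<in> N" and q: "q \<in> N"
    have "N \<subseteq> {q. b * a * c * q \<in> I}" for b c
    proof (rule minN)
      show "csubspace {q. b * a * c * q \<in> I}"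
        by (rule complex_vector.subspaceI)
          (auto simp: D(2) distrib_left mult_scaleC_right intro: D)
      show "e * a * f \<in> {q. b * a * c * q \<in> I}" for e f
        using D(7)[OF D(6)[OF a[of "c * e"], of b], of f] by (simp add: mult.assoc)
    qed
    with q have q': "b * a * c * q \<in> I" for b c by blast
    have "N \<subseteq> {p. p * q \<in> I}"
    proof (rule minN)
      show "csubspace {p. p * q \<in> I}"
        by (rule complex_vector.subspaceI)
          (auto simp: D(2) distrib_right mult_scaleC_left intro: D)
    qed (use q' in simp)
    with p show "p * q \<in> I" by blast
  qed
  with genN have "a \<in> J" unfolding J_def by blast
  with JI show ?thesis by blast
qed

text \<open>Modulo \<open>I\<close>, the derivation \<open>d = [u, _]\<close> satisfies \<open>d\<^sup>2 = 0\<close>. The Leibniz rule for \<open>d\<^sup>2(xy)\<close>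
  then reads \<open>2 d(x) d(y) = 0\<close>, and putting \<open>yx\<close> for \<open>y\<close> gives \<open>d(x) y d(x) = 0\<close>.\<close>

lemma commutator_mem_if_double_commutator_mem:
  assumes I: "semiprime_ideal I" and dd: "\<And>x. commutator u (commutator u x) \<in> I"
  shows "commutator u x \<in> I"
proof -
  define d where "d = commutator u"
  have "two_sided_ideal I" using I unfolding semiprime_ideal_def by blast
  note D = two_sided_idealD[OF this]
  have leibniz: "d (x * y) = d x * y + x * d y" for x y
    unfolding d_def commutator_def by (simp add: algebra_simps)
  have prod: "d x * d y \<in> I" for x y
  proof -
    have "d x * d y + d x * d y = d (d (x * y)) - d (d x) * y - x * d (d y)"
      unfolding d_def commutator_def by (simp add: algebra_simps)
    moreover have "\<dots> \<in> I"
      using dd unfolding d_def by (intro D)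
    ultimately show ?thesis
      using csubspace_double_iff[OF D(1), of "d x * d y"] by argo
  qed
  have "d x * y * d x \<in> I" for y
  proof -
    have "d x * y * d x = d x * d (y * x) - d x * d y * x"
      by (simp add: leibniz algebra_simps)
    then show ?thesis using prod D(4,7) by simp
  qed
  then show ?thesis using semiprime_ideal_sandwich[OF I] unfolding d_def by blast
qed

text \<open>Modulo \<open>I\<close>, let \<open>z = d\<^sup>2(x)\<close> with \<open>d = [u, _]\<close>. Both \<open>z\<close> and \<open>zu = d\<^sup>2(xu)\<close> are central, so
  \<open>z[u,y] = [zu,y] = 0\<close> for all \<open>y\<close>, in particular \<open>z\<^sup>2 = 0\<close>. A central element of square zero
  vanishes.\<close>

lemma double_commutator_mem_if_central:
  assumes I: "semiprime_ideal I"
    and central: "\<And>x y. commutator (commutator u (commutator u x)) y \<in> I"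
  shows "commutator u (commutator u x) \<in> I"
proof -
  have "two_sided_ideal I" using I unfolding semiprime_ideal_def by blast
  note D = two_sided_idealD[OF this]
  define z where "z = commutator u (commutator u x)"
  have z: "commutator z y \<in> I" for y
    unfolding z_def by (rule central)
  have "commutator u (commutator u (x * u)) = z * u"
    unfolding z_def commutator_def by (simp add: algebra_simps)
  then have zu: "commutator (z * u) y \<in> I" for y
    using central[of "x * u" y] by simp
  have "z * commutator u y \<in> I" for y
  proof -
    have "z * commutator u y = commutator (z * u) y - commutator z y * u"
      by (simp add: commutator_def algebra_simps)
    then show ?thesis using D(4)[OF zu D(7)[OF z]] by simp
  qed
  then have zz: "z * z \<in> I" by (subst (2) z_def)
  have "z * a * z \<in> I" for a
  proof -
    have "z * a * z = z * z * a - z * commutator z a"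
      by (simp add: commutator_def algebra_simps)
    then show ?thesis using D(4)[OF D(7)[OF zz] D(6)[OF z]] by simp
  qed
  then show ?thesis using semiprime_ideal_sandwich[OF I] unfolding z_def by blast
qed

lemma lie_ideal_commutators_central_mod:
  assumes I: "semiprime_ideal I" and K: "lie_ideal K"
    and KK: "\<And>x y. x \<in> K \<Longrightarrow> y \<in> K \<Longrightarrow> commutator x y \<in> full_normalizer I"
  shows "K \<subseteq> full_normalizer I"
proof
  fix u assume u: "u \<in> K"
  have "two_sided_ideal I" using I unfolding semiprime_ideal_def by blast
  note lie = lie_idealD[OF two_sided_ideal_imp_lie_ideal[OF this]]
  have "commutator y (commutator u (commutator u x)) \<in> I" for x y
    using KK[OF u lie_idealD(3)[OF K u]] mem_full_normalizer_iff[OF lie(1)] by blast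
  then have "commutator (commutator u (commutator u x)) y \<in> I" for x y
    using complex_vector.subspace_neg[OF lie(1)] commutator_minus_swap by metis
  then have "commutator u x \<in> I" for x
    using commutator_mem_if_double_commutator_mem[OF I] double_commutator_mem_if_central[OF I]
    by blast
  then have "commutator x u \<in> I" for x
    using complex_vector.subspace_neg[OF lie(1)] commutator_minus_swap by metis
  then show "u \<in> full_normalizer I" by (simp add: mem_full_normalizer_iff[OF lie(1)])
qed

section \<open>Commutative ideals of the quotient\<close>

lemma coset_eq_iff:
  assumes "two_sided_ideal I"
  shows "coset I a = coset I b \<longleftrightarrow> a - b \<in> I"
proof
  note D = two_sided_idealD[OF assms]
  assume "coset I a = coset I b"
  moreover have "a \<in> coset I a"
    using D(2) unfolding coset_def by (metis add.right_neutral image_eqI)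
  ultimately obtain x where "a = b + x" "x \<in> I" unfolding coset_def by auto
  then show "a - b \<in> I" by simp
next
  note D = two_sided_idealD[OF assms]
  assume ab: "a - b \<in> I"
  show "coset I a = coset I b"
  proof (rule set_eqI)
    fix y
    have mem: "y \<in> coset I e \<longleftrightarrow> y - e \<in> I" for e
      unfolding coset_def by (auto intro: image_eqI[of _ _ "y - e"])
    show "y \<in> coset I a \<longleftrightarrow> y \<in> coset I b"
      unfolding mem using D(3)[OF _ ab, of "y - a"] D(4)[OF _ ab, of "y - b"] by auto
  qed
qed

lemma UN_coset_const:
  assumes "two_sided_ideal I" and "\<And>x. x \<in> I \<Longrightarrow> f (a + x) = C"
  shows "(\<Union>e\<in>coset I a. f e) = C"
  using assms(2) two_sided_idealD(2)[OF assms(1)] unfolding coset_def by auto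

lemma quot_operations_coset:
  assumes "two_sided_ideal I"
  shows quot_add_coset: "quot_add I (coset I a) (coset I b) = coset I (a + b)"
    and quot_scaleC_coset: "quot_scaleC I c (coset I a) = coset I (c *\<^sub>C a)"
    and quot_mult_coset: "quot_mult I (coset I a) (coset I b) = coset I (a * b)"
proof -
  note D = two_sided_idealD[OF assms]
  show "quot_add I (coset I a) (coset I b) = coset I (a + b)"
    unfolding quot_add_def
    by (intro UN_coset_const[OF assms]) (auto simp: coset_eq_iff[OF assms] intro: D)
  show "quot_scaleC I c (coset I a) = coset I (c *\<^sub>C a)"
    unfolding quot_scaleC_def
    by (intro UN_coset_const[OF assms])
      (auto simp: coset_eq_iff[OF assms] scaleC_add_right intro: D)
  have "(a + x) * (b + y) - a * b \<in> I" if "x \<in> I" "y \<in> I" for x y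
  proof -
    have "(a + x) * (b + y) - a * b = a * y + x * (b + y)"
      by (simp add: algebra_simps)
    then show ?thesis using D(3)[OF D(6) D(7)] that by simp
  qed
  then show "quot_mult I (coset I a) (coset I b) = coset I (a * b)"
    unfolding quot_mult_def
    by (intro UN_coset_const[OF assms]) (simp add: coset_eq_iff[OF assms])
qed

text \<open>Images and preimages under \<open>A \<rightarrow> A/I\<close> translate the condition on \<open>A/I\<close> into one on ideals of
  \<open>A\<close> itself, which need not contain \<open>I\<close>.\<close>

lemma quot_no_nonzero_commutative_ideal_iff:
  assumes I: "two_sided_ideal I"
  shows "quot_no_nonzero_commutative_ideal I \<longleftrightarrow>
    (\<forall>J. two_sided_ideal J \<longrightarrow> (\<forall>x\<in>J. \<forall>y\<in>J. commutator x y \<in> I) \<longrightarrow> J \<subseteq> I)"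
    (is "_ \<longleftrightarrow> ?rhs")
proof
  note ops = quot_operations_coset[OF I]
  assume no: "quot_no_nonzero_commutative_ideal I"
  show ?rhs
  proof (intro allI impI)
    fix J assume J: "two_sided_ideal J" and comm: "\<forall>x\<in>J. \<forall>y\<in>J. commutator x y \<in> I"
    note D = two_sided_idealD[OF J]
    have "quot_two_sided_ideal I (coset I ` J)"
      unfolding quot_two_sided_ideal_def quot_def by (auto simp: ops intro: D)
    moreover have "quot_commutative I (coset I ` J)"
      using comm unfolding quot_commutative_def commutator_def
      by (auto simp: ops coset_eq_iff[OF I])
    ultimately have "coset I ` J = {coset I 0}"
      using no unfolding quot_no_nonzero_commutative_ideal_def by blast
    then have "coset I x = coset I 0" if "x \<in> J" for x using that by blast
    then show "J \<subseteq> I" by (auto simp: coset_eq_iff[OF I])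
  qed
next
  note ops = quot_operations_coset[OF I]
  assume rhs: ?rhs
  have "Q = {coset I 0}"
    if Q: "quot_two_sided_ideal I Q" and comm: "quot_commutative I Q" for Q
  proof -
    define J where "J = {a. coset I a \<in> Q}"
    have QJ: "Q = coset I ` J"
      using Q unfolding J_def quot_two_sided_ideal_def quot_def by auto
    have cosets: "coset I 0 \<in> Q"
      "\<And>a b. coset I a \<in> Q \<Longrightarrow> coset I b \<in> Q \<Longrightarrow> coset I (a + b) \<in> Q"
      "\<And>c a. coset I a \<in> Q \<Longrightarrow> coset I (c *\<^sub>C a) \<in> Q"
      "\<And>a b. coset I a \<in> Q \<Longrightarrow> coset I (b * a) \<in> Q \<and> coset I (a * b) \<in> Q"
      using Q unfolding quot_two_sided_ideal_def quot_def by (auto simp flip: ops)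
    have "two_sided_ideal J"
      unfolding two_sided_ideal_def J_def
      using cosets by (auto intro!: complex_vector.subspaceI)
    moreover have "commutator x y \<in> I" if "x \<in> J" "y \<in> J" for x y
    proof -
      have "quot_mult I (coset I x) (coset I y) = quot_mult I (coset I y) (coset I x)"
        using comm that unfolding quot_commutative_def J_def by blast
      then show ?thesis by (simp add: ops coset_eq_iff[OF I] commutator_def)
    qed
    ultimately have "J \<subseteq> I" using rhs by blast
    then have "coset I x = coset I 0" if "x \<in> J" for x
      using that by (auto simp: coset_eq_iff[OF I])
    moreover have "0 \<in> J" using cosets(1) unfolding J_def by simp
    ultimately show ?thesis unfolding QJ by blast
  qed
  then show "quot_no_nonzero_commutative_ideal I"
    unfolding quot_no_nonzero_commutative_ideal_def by blast
qed

section \<open>From ideals to Lie ideals\<close>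

lemma prime_imp_semiprime_ideal: "prime_ideal I \<Longrightarrow> semiprime_ideal I"
  unfolding prime_ideal_def semiprime_ideal_def by blast

lemma prime_imp_semiprime_lie_ideal: "prime_lie_ideal L \<Longrightarrow> semiprime_lie_ideal L"
  unfolding prime_lie_ideal_def semiprime_lie_ideal_def by blast

lemma ideal_core_full_normalizer:
  assumes I: "two_sided_ideal I" and no: "quot_no_nonzero_commutative_ideal I"
  shows "ideal_core (full_normalizer I) = I"
proof
  have sub: "csubspace I" using I by (rule two_sided_idealD)
  show "I \<subseteq> ideal_core (full_normalizer I)"
    by (intro ideal_core_greatest lie_ideal_subset_full_normalizer
        two_sided_ideal_imp_lie_ideal I)
  have "commutator x y \<in> I" if "y \<in> ideal_core (full_normalizer I)" for x y
    using that ideal_core_subset mem_full_normalizer_iff[OF sub] by blast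
  moreover have "two_sided_ideal (ideal_core (full_normalizer I))"
    by (intro two_sided_ideal_ideal_core csubspace_full_normalizer sub)
  ultimately show "ideal_core (full_normalizer I) \<subseteq> I"
    using no unfolding quot_no_nonzero_commutative_ideal_iff[OF I] by blast
qed

lemma semiprime_lie_ideal_full_normalizer:
  assumes I: "semiprime_ideal I"
  shows "semiprime_lie_ideal (full_normalizer I)"
proof -
  have "two_sided_ideal I" using I unfolding semiprime_ideal_def by blast
  then have lie: "lie_ideal (full_normalizer I)"
    by (intro lie_ideal_full_normalizer two_sided_ideal_imp_lie_ideal)
  with lie_ideal_commutators_central_mod[OF I] show ?thesis
    unfolding semiprime_lie_ideal_def commutator_span_subset_iff[OF lie_idealD(1)[OF lie]] by blast
qed

text \<open>Herstein's observation that a Lie ideal which is not central modulo \<open>I\<close> comes with an ideal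
  \<open>M\<close>, not inside \<open>I\<close>, for which \<open>[A,M]\<close> lies in the Lie ideal.\<close>

lemma ideal_core_full_normalizer_not_subset:
  assumes I: "semiprime_ideal I" and K: "lie_ideal K" and not: "\<not> K \<subseteq> full_normalizer I"
  shows "\<not> ideal_core (full_normalizer K) \<subseteq> I"
proof
  assume core: "ideal_core (full_normalizer K) \<subseteq> I"
  have "two_sided_ideal I" using I unfolding semiprime_ideal_def by blast
  then have "I \<subseteq> full_normalizer I"
    by (intro lie_ideal_subset_full_normalizer two_sided_ideal_imp_lie_ideal)
  moreover have "commutator x y \<in> I" if "x \<in> K" "y \<in> K" for x y
    using commutator_mem_ideal_core[OF lie_ideal_full_normalizer[OF K]
        full_normalizer_mult[OF lie_idealD(1)[OF K]]]
      lie_ideal_subset_full_normalizer[OF K] that core by blast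
  ultimately have "K \<subseteq> full_normalizer I"
    by (intro lie_ideal_commutators_central_mod[OF I K]) blast
  with not show False ..
qed

lemma prime_lie_ideal_full_normalizer:
  assumes I: "prime_ideal I" and no: "quot_no_nonzero_commutative_ideal I"
  shows "prime_lie_ideal (full_normalizer I)"
proof -
  have ideal: "two_sided_ideal I" and proper: "I \<noteq> UNIV"
    and prime: "\<And>J\<^sub>1 J\<^sub>2. two_sided_ideal J\<^sub>1 \<Longrightarrow> two_sided_ideal J\<^sub>2 \<Longrightarrow>
      ideal_prod J\<^sub>1 J\<^sub>2 \<subseteq> I \<Longrightarrow> J\<^sub>1 \<subseteq> I \<or> J\<^sub>2 \<subseteq> I"
    using I unfolding prime_ideal_def by blast+
  note semi = prime_imp_semiprime_ideal[OF I]
  note core = ideal_core_full_normalizer[OF ideal no]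
  have sub: "csubspace I" using ideal by (rule two_sided_idealD)
  have lie: "lie_ideal (full_normalizer I)"
    by (intro lie_ideal_full_normalizer two_sided_ideal_imp_lie_ideal ideal)
  have "full_normalizer I \<noteq> UNIV"
  proof
    assume "full_normalizer I = UNIV"
    then have "I = UNIV" using core by (simp add: ideal_core_def)
    with proper show False ..
  qed
  moreover have "K \<subseteq> full_normalizer I \<or> L \<subseteq> full_normalizer I"
    if K: "lie_ideal K" and L: "lie_ideal L"
      and KL: "\<And>x y. x \<in> K \<Longrightarrow> y \<in> L \<Longrightarrow> commutator x y \<in> full_normalizer I" for K L
  proof (rule ccontr)
    let ?K = "ideal_core (full_normalizer K)" and ?L = "ideal_core (full_normalizer L)"
    let ?M = "?K \<inter> ?L"
    assume "\<not> (K \<subseteq> full_normalizer I \<or> L \<subseteq> full_normalizer I)"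
    then have not: "\<not> ?K \<subseteq> I" "\<not> ?L \<subseteq> I"
      using ideal_core_full_normalizer_not_subset[OF semi] K L by blast+
    have cores: "two_sided_ideal ?K" "two_sided_ideal ?L"
      using K L by (simp_all add: two_sided_ideal_ideal_core csubspace_full_normalizer lie_idealD(1))
    then have M: "two_sided_ideal ?M" by (rule two_sided_ideal_Int)
    have "ideal_prod ?K ?L \<subseteq> ?M"
      unfolding ideal_prod_subset_iff[OF two_sided_idealD(1)[OF M]]
      by (intro ballI IntI two_sided_idealD(7)[OF cores(1)] two_sided_idealD(6)[OF cores(2)])
    with prime[OF cores] not have "\<not> ?M \<subseteq> I" by blast
    have "K \<inter> L \<subseteq> full_normalizer I"
      using KL by (intro lie_ideal_commutators_central_mod[OF semi lie_ideal_Int[OF K L]]) blast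
    moreover have "commutator x y \<in> K \<inter> L" if "y \<in> ?M" for x y
      using that ideal_core_subset mem_full_normalizer_iff[OF lie_idealD(1)[OF K]]
        mem_full_normalizer_iff[OF lie_idealD(1)[OF L]] by blast
    ultimately have "?M \<subseteq> full_normalizer I"
      by (intro lie_ideal_commutators_central_mod[OF semi two_sided_ideal_imp_lie_ideal[OF M]])
        blast
    then have "?M \<subseteq> I" using ideal_core_greatest[OF M] core by blast
    with \<open>\<not> ?M \<subseteq> I\<close> show False ..
  qed
  ultimately show ?thesis
    using lie unfolding prime_lie_ideal_def commutator_span_subset_iff[OF lie_idealD(1)[OF lie]]
    by blast
qed

section \<open>From Lie ideals to ideals\<close>

lemma full_normalizer_semiprime_lie_ideal:
  assumes L: "semiprime_lie_ideal L"
  shows "full_normalizer L = L"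
proof
  have lie: "lie_ideal L" using L unfolding semiprime_lie_ideal_def by blast
  then show "L \<subseteq> full_normalizer L" by (rule lie_ideal_subset_full_normalizer)
  have "commutator_span (full_normalizer L) (full_normalizer L) \<subseteq> L"
    using commutator_span_subset_iff mem_full_normalizer_iff lie_idealD(1)[OF lie] by blast
  then show "full_normalizer L \<subseteq> L"
    using L lie_ideal_full_normalizer[OF lie] unfolding semiprime_lie_ideal_def by blast
qed

text \<open>A two-sided ideal is also a Lie ideal, so semiprimeness of \<open>L\<close> can be tested on it. Both the
  semiprimeness of the ideal core and the absence of commutative ideals modulo it come from here.\<close>

lemma ideal_subset_ideal_core_if_commutators:
  assumes L: "semiprime_lie_ideal L" and J: "two_sided_ideal J"
    and comm: "\<And>x y. x \<in> J \<Longrightarrow> y \<in> J \<Longrightarrow> commutator x y \<in> L"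
  shows "J \<subseteq> ideal_core L"
proof (rule ideal_core_greatest[OF J])
  have "csubspace L" using L lie_idealD(1) unfolding semiprime_lie_ideal_def by blast
  then have "commutator_span J J \<subseteq> L"
    using comm commutator_span_subset_iff by blast
  then show "J \<subseteq> L"
    using L two_sided_ideal_imp_lie_ideal[OF J] unfolding semiprime_lie_ideal_def by blast
qed

lemma ideal_core_semiprime_lie_ideal:
  assumes L: "semiprime_lie_ideal L"
  shows "semiprime_ideal (ideal_core L)"
    and "quot_no_nonzero_commutative_ideal (ideal_core L)"
    and "full_normalizer (ideal_core L) = L"
proof -
  have lie: "lie_ideal L" using L unfolding semiprime_lie_ideal_def by blast
  have I: "two_sided_ideal (ideal_core L)"
    using two_sided_ideal_ideal_core lie_idealD(1)[OF lie] .
  note D = two_sided_idealD[OF I]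
  note TL = full_normalizer_semiprime_lie_ideal[OF L]
  note commutators = ideal_subset_ideal_core_if_commutators[OF L]
  show semi: "semiprime_ideal (ideal_core L)"
    unfolding semiprime_ideal_def ideal_prod_subset_iff[OF D(1)]
  proof (intro conjI I allI impI)
    fix J assume J: "two_sided_ideal J" and JJ: "\<forall>x\<in>J. \<forall>y\<in>J. x * y \<in> ideal_core L"
    then have "commutator x y \<in> L" if "x \<in> J" "y \<in> J" for x y
      unfolding commutator_def using D(4) ideal_core_subset that by blast
    then show "J \<subseteq> ideal_core L" by (rule commutators[OF J])
  qed
  show "quot_no_nonzero_commutative_ideal (ideal_core L)"
    unfolding quot_no_nonzero_commutative_ideal_iff[OF I]
    using commutators ideal_core_subset by blast
  show "full_normalizer (ideal_core L) = L"
  proof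
    show "full_normalizer (ideal_core L) \<subseteq> L"
      using full_normalizer_mono[OF ideal_core_subset, of L] unfolding TL .
    have "x * y \<in> L" if "x \<in> L" "y \<in> L" for x y
      using full_normalizer_mult[OF lie_idealD(1)[OF lie]] that unfolding TL .
    then have "commutator x y \<in> ideal_core L" if "x \<in> L" "y \<in> L" for x y
      using commutator_mem_ideal_core[OF lie] that by blast
    moreover have "ideal_core L \<subseteq> full_normalizer (ideal_core L)"
      by (intro lie_ideal_subset_full_normalizer two_sided_ideal_imp_lie_ideal I)
    ultimately show "L \<subseteq> full_normalizer (ideal_core L)"
      by (intro lie_ideal_commutators_central_mod[OF semi lie]) blast
  qed
qed

text \<open>Primeness of \<open>L\<close> applies to ideals with \<open>[J\<^sub>1,J\<^sub>2] \<subseteq> L\<close>, so \<open>J\<^sub>2J\<^sub>1\<close> has to lie in the core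
  together with \<open>J\<^sub>1J\<^sub>2\<close>. It does by semiprimeness: \<open>(yx)a(yx) = y(xay)x\<close>.\<close>

lemma prime_ideal_ideal_core:
  assumes L: "prime_lie_ideal L"
  shows "prime_ideal (ideal_core L)"
proof -
  have lie: "lie_ideal L" and proper: "L \<noteq> UNIV"
    and prime: "\<And>K\<^sub>1 K\<^sub>2. lie_ideal K\<^sub>1 \<Longrightarrow> lie_ideal K\<^sub>2 \<Longrightarrow>
      commutator_span K\<^sub>1 K\<^sub>2 \<subseteq> L \<Longrightarrow> K\<^sub>1 \<subseteq> L \<or> K\<^sub>2 \<subseteq> L"
    using L unfolding prime_lie_ideal_def by blast+
  note semi = ideal_core_semiprime_lie_ideal(1)[OF prime_imp_semiprime_lie_ideal[OF L]]
  have I: "two_sided_ideal (ideal_core L)"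
    using two_sided_ideal_ideal_core lie_idealD(1)[OF lie] .
  note D = two_sided_idealD[OF I]
  have "J\<^sub>1 \<subseteq> ideal_core L \<or> J\<^sub>2 \<subseteq> ideal_core L"
    if J: "two_sided_ideal J\<^sub>1" "two_sided_ideal J\<^sub>2"
      and prod: "\<And>x y. x \<in> J\<^sub>1 \<Longrightarrow> y \<in> J\<^sub>2 \<Longrightarrow> x * y \<in> ideal_core L" for J\<^sub>1 J\<^sub>2
  proof -
    have swapped: "y * x \<in> ideal_core L" if "x \<in> J\<^sub>1" "y \<in> J\<^sub>2" for x y
    proof (rule semiprime_ideal_sandwich[OF semi])
      fix a
      have "y * (x * (a * y)) * x \<in> ideal_core L"
        using that by (intro D(6,7) prod two_sided_idealD(6)[OF J(2)])
      then show "y * x * a * (y * x) \<in> ideal_core L" by (simp add: mult.assoc)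
    qed
    have "commutator_span J\<^sub>1 J\<^sub>2 \<subseteq> L"
      unfolding commutator_span_subset_iff[OF lie_idealD(1)[OF lie]] commutator_def
      using D(4)[OF prod swapped] ideal_core_subset by blast
    then have "J\<^sub>1 \<subseteq> L \<or> J\<^sub>2 \<subseteq> L"
      by (intro prime two_sided_ideal_imp_lie_ideal J)
    then show ?thesis using ideal_core_greatest J by blast
  qed
  moreover have "ideal_core L \<noteq> UNIV" using proper ideal_core_subset by blast
  ultimately show ?thesis
    using I unfolding prime_ideal_def ideal_prod_subset_iff[OF D(1)] by blast
qed

section \<open>The bijections\<close>

theorem theorem1:
  shows "bij_betw full_normalizer
      {I :: 'a::c_star_algebra set. semiprime_ideal I \<and> quot_no_nonzero_commutative_ideal I}
      {L. semiprime_lie_ideal L}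
    \<and> {I :: 'a set. prime_ideal I \<and> quot_no_nonzero_commutative_ideal I}
        \<subseteq> {I. semiprime_ideal I \<and> quot_no_nonzero_commutative_ideal I}
    \<and> {L :: 'a set. prime_lie_ideal L} \<subseteq> {L. semiprime_lie_ideal L}
    \<and> bij_betw full_normalizer
        {I :: 'a set. prime_ideal I \<and> quot_no_nonzero_commutative_ideal I}
        {L. prime_lie_ideal L}"
proof (intro conjI)
  show "bij_betw full_normalizer
      {I :: 'a set. semiprime_ideal I \<and> quot_no_nonzero_commutative_ideal I}
      {L. semiprime_lie_ideal L}"
  proof (rule bij_betw_byWitness[where f' = ideal_core])
    show "\<forall>I\<in>{I :: 'a set. semiprime_ideal I \<and> quot_no_nonzero_commutative_ideal I}.
        ideal_core (full_normalizer I) = I"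
      using ideal_core_full_normalizer unfolding semiprime_ideal_def by blast
  qed (auto simp: ideal_core_semiprime_lie_ideal intro: semiprime_lie_ideal_full_normalizer)
  show "bij_betw full_normalizer
      {I :: 'a set. prime_ideal I \<and> quot_no_nonzero_commutative_ideal I}
      {L. prime_lie_ideal L}"
  proof (rule bij_betw_byWitness[where f' = ideal_core])
    show "\<forall>I\<in>{I :: 'a set. prime_ideal I \<and> quot_no_nonzero_commutative_ideal I}.
        ideal_core (full_normalizer I) = I"
      using ideal_core_full_normalizer unfolding prime_ideal_def by blast
  qed (auto simp: prime_imp_semiprime_lie_ideal ideal_core_semiprime_lie_ideal
      intro: prime_ideal_ideal_core prime_lie_ideal_full_normalizer)
qed (auto intro: prime_imp_semiprime_ideal prime_imp_semiprime_lie_ideal)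

end
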